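(* Let $\mathcal{H}$ be an infinite-dimensional separable complex Hilbert space and let $T$ be a bitriangular operator on $\mathcal{H}$. Then either $T$ can be written as $\lambda I + F$ where $\lambda \in \mathbb{C}$ and $F$ is a finite-rank operator, or $T$ has a hyperinvariant half-space. In particular, $T$ has an invariant half-space.
   Context: All operators are bounded and linear, and all subspaces are assumed to be norm-closed. A half-space of $\mathcal{H}$ is a subspace of infinite dimension and infinite codimension. An operator $T$ on $\mathcal{H}$ is triangular if there is an orthonormal basis $(e_n)_{n=1}^\infty$ of $\mathcal{H}$ such that $\langle T e_j, e_i\rangle = 0$ whenever $i > j$. $T$ is bitriangular if both $T$ and $T^*$ are triangular, perhaps with respect to different orthonormal bases. A subspace is hyperinvariant for $T$ if it is invariant under every bounded operator commuting with $T$. *)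

theory Defs
  imports "HOL-Analysis.Analysis"
begin

class complex_vector = real_vector +
  fixes scaleC :: "complex \<Rightarrow> 'a \<Rightarrow> 'a" (infixr "*\<^sub>C" 75)
  assumes scaleC_add_right: "a *\<^sub>C (x + y) = a *\<^sub>C x + a *\<^sub>C y"
    and scaleC_add_left: "(a + b) *\<^sub>C x = a *\<^sub>C x + b *\<^sub>C x"
    and scaleC_scaleC: "a *\<^sub>C (b *\<^sub>C x) = (a * b) *\<^sub>C x"
    and scaleC_one: "1 *\<^sub>C x = x"
    and scaleR_scaleC: "r *\<^sub>R x = complex_of_real r *\<^sub>C x"

global_interpretation complex_vector: vector_space "scaleC :: complex \<Rightarrow> 'a \<Rightarrow> 'a::complex_vector"
  by unfold_locales (simp_all add: scaleC_add_right scaleC_add_left scaleC_scaleC scaleC_one)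

(* A complex inner product space also carries the real inner product Re <x, y>. Building on
   real_inner makes the norm and its topology those of the library; positive definiteness
   and norm x = sqrt <x, x> come from real_inner together with inner_eq_Re_cinner.
   The inner product is linear in its first argument. *)
class complex_inner = complex_vector + real_inner +
  fixes cinner :: "'a \<Rightarrow> 'a \<Rightarrow> complex"
  assumes cinner_commute: "cinner x y = cnj (cinner y x)"
    and cinner_add_left: "cinner (x + y) z = cinner x z + cinner y z"
    and cinner_scaleC_left: "cinner (a *\<^sub>C x) y = a * cinner x y"
    and inner_eq_Re_cinner: "inner x y = Re (cinner x y)"

class complex_hilbert_space = complex_inner + complete_space

lemma cinner_self_eq_norm: "cinner x x = complex_of_real ((norm x)\<^sup>2)"
  for x :: "'a::complex_inner"
proof -
  have "Im (cinner x x) = 0"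
    using arg_cong[OF cinner_commute[of x x], of Im] by simp
  thus ?thesis
    by (simp add: complex_eq_iff power2_norm_eq_inner inner_eq_Re_cinner)
qed

definition bounded_clinear :: "('a::complex_inner \<Rightarrow> 'a) \<Rightarrow> bool" where
  "bounded_clinear T \<longleftrightarrow> bounded_linear T \<and> (\<forall>c x. T (c *\<^sub>C x) = c *\<^sub>C T x)"

(* For a bounded operator on a Hilbert space the adjoint exists by the Riesz representation
   theorem; it is unique by cadjoint_eqI below. *)
definition cadjoint :: "('a::complex_inner \<Rightarrow> 'a) \<Rightarrow> 'a \<Rightarrow> 'a" where
  "cadjoint T = (THE S. \<forall>x y. cinner (T x) y = cinner x (S y))"

lemma cadjoint_eqI:
  assumes "\<And>x y. cinner (T x) y = cinner x (S y)"
  shows "cadjoint T = S"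
  unfolding cadjoint_def
proof (rule the_equality)
  show "\<forall>x y. cinner (T x) y = cinner x (S y)"
    using assms by blast
next
  fix S' assume S': "\<forall>x y. cinner (T x) y = cinner x (S' y)"
  show "S' = S"
  proof
    fix y
    have "cinner x (S' y) = cinner x (S y)" for x
      using assms S' by metis
    hence "inner x (S' y) = inner x (S y)" for x
      by (simp add: inner_eq_Re_cinner)
    hence "inner x (S' y - S y) = 0" for x
      by (simp add: inner_diff_right)
    hence "S' y - S y = 0"
      by (metis inner_eq_zero_iff)
    thus "S' y = S y" by simp
  qed
qed

definition orthonormal_basis :: "(nat \<Rightarrow> 'a::complex_inner) \<Rightarrow> bool" where
  "orthonormal_basis e \<longleftrightarrow>
     (\<forall>i j. cinner (e i) (e j) = (if i = j then 1 else 0)) \<and>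
     closure (complex_vector.span (range e)) = UNIV"

definition triangular :: "('a::complex_inner \<Rightarrow> 'a) \<Rightarrow> bool" where
  "triangular T \<longleftrightarrow>
     (\<exists>e. orthonormal_basis e \<and> (\<forall>i j. i > j \<longrightarrow> cinner (T (e j)) (e i) = 0))"

definition bitriangular :: "('a::complex_inner \<Rightarrow> 'a) \<Rightarrow> bool" where
  "bitriangular T \<longleftrightarrow> triangular T \<and> triangular (cadjoint T)"

definition closed_csubspace :: "'a::complex_inner set \<Rightarrow> bool" where
  "closed_csubspace M \<longleftrightarrow> complex_vector.subspace M \<and> closed M"

definition finite_cdim :: "'a::complex_vector set \<Rightarrow> bool" where
  "finite_cdim M \<longleftrightarrow> (\<exists>B. finite B \<and> M = complex_vector.span B)"

(* The quotient by M is finite-dimensional iff it is spanned by the classes of finitely many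
   vectors, i.e. iff finitely many vectors together with M span the whole space. *)
definition finite_ccodim :: "'a::complex_vector set \<Rightarrow> bool" where
  "finite_ccodim M \<longleftrightarrow> (\<exists>B. finite B \<and> complex_vector.span (M \<union> B) = UNIV)"

definition half_space :: "'a::complex_inner set \<Rightarrow> bool" where
  "half_space M \<longleftrightarrow> closed_csubspace M \<and> \<not> finite_cdim M \<and> \<not> finite_ccodim M"

definition invariant_under :: "('a \<Rightarrow> 'a) \<Rightarrow> 'a set \<Rightarrow> bool" where
  "invariant_under A M \<longleftrightarrow> A ` M \<subseteq> M"

definition hyperinvariant :: "('a::complex_inner \<Rightarrow> 'a) \<Rightarrow> 'a set \<Rightarrow> bool" where
  "hyperinvariant T M \<longleftrightarrow>
     (\<forall>A. bounded_clinear A \<and> A \<circ> T = T \<circ> A \<longrightarrow> invariant_under A M)"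

definition finite_rank :: "('a::complex_inner \<Rightarrow> 'a) \<Rightarrow> bool" where
  "finite_rank F \<longleftrightarrow> bounded_clinear F \<and> finite_cdim (range F)"

end

theory Submission
  imports Defs
begin

text \<open>
  Back substitution along a triangularizing basis puts every basis vector into the algebraic
  span of the generalized eigenvectors. If some eigenspace \<open>ker (T - a)\<close> is infinite-dimensional,
  then it is a hyperinvariant half-space or \<open>T - a\<close> has finite rank. If all eigenspaces are
  finite-dimensional, totality of the generalized eigenvectors of the adjoint forces every
  \<open>T - a\<close> to have finite ascent: a nonzero vector in \<open>ker (T - a)\<close> and in the range of every power
  of \<open>T - a\<close> would be orthogonal to all of them. Hence the generalized eigenspaces are
  finite-dimensional, there are infinitely many eigenvalues, and the closed span of the eigenspaces
  for every other eigenvalue is a half-space, its orthogonal complement containing generalized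
  eigenvectors of the adjoint for the remaining eigenvalues.
\<close>

section \<open>Finite-dimensional complex subspaces\<close>

abbreviation clinear :: "('a::complex_vector \<Rightarrow> 'a) \<Rightarrow> bool" where
  "clinear \<equiv> Vector_Spaces.linear scaleC scaleC"

global_interpretation clinear: vector_space_pair
  "scaleC :: complex \<Rightarrow> 'a \<Rightarrow> 'a::complex_vector" "scaleC :: complex \<Rightarrow> 'a \<Rightarrow> 'a"
  by unfold_locales

lemma clinearI:
  assumes "\<And>x y. T (x + y) = T x + T y" and "\<And>c x. T (c *\<^sub>C x) = c *\<^sub>C T x"
  shows "clinear T"
  using assms by unfold_locales auto

lemma finite_cdim_subspace:
  fixes M :: "'a::complex_vector set"
  assumes M: "complex_vector.subspace M" and sub: "M \<subseteq> complex_vector.span B" and fin: "finite B"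
  obtains C where "finite C" "complex_vector.independent C" "C \<subseteq> M" "M = complex_vector.span C"
proof -
  obtain C where C: "C \<subseteq> M" "complex_vector.independent C" "M \<subseteq> complex_vector.span C"
    using complex_vector.maximal_independent_subset[of M] by blast
  have "finite C"
    using complex_vector.independent_span_bound[OF fin C(2)] C(1) sub by auto
  moreover have "M = complex_vector.span C"
    using C M by (simp add: complex_vector.span_minimal subset_antisym)
  ultimately show thesis using that C by blast
qed

lemma finite_cdim_mono:
  fixes M :: "'a::complex_vector set"
  assumes "finite_cdim N" "complex_vector.subspace M" "M \<subseteq> N"
  shows "finite_cdim M"
  using assms finite_cdim_subspace unfolding finite_cdim_def by metis

text \<open>One added generator \<open>s\<close> covers \<open>N\<close>; this is the induction step
  when linear conditions are imposed one at a time.\<close>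

lemma finite_cdim_insert:
  assumes "finite_cdim M" "\<And>x. x \<in> N \<Longrightarrow> \<exists>c. x - c *\<^sub>C s \<in> M" "complex_vector.subspace N"
  shows "finite_cdim N"
proof -
  obtain B where B: "finite B" "M = complex_vector.span B"
    using assms(1) unfolding finite_cdim_def by blast
  have "N \<subseteq> complex_vector.span (insert s B)"
    using assms(2) B(2) by (auto simp: complex_vector.span_insert)
  moreover have "finite_cdim (complex_vector.span (insert s B))"
    unfolding finite_cdim_def using B(1) by blast
  ultimately show ?thesis using finite_cdim_mono assms(3) by blast
qed

text \<open>Lifts of generators of the image, together with generators of the kernel, generate the
  preimage.\<close>

lemma finite_cdim_vimage:
  fixes f :: "'a::complex_vector \<Rightarrow> 'a"
  assumes f: "clinear f" and ker: "finite_cdim {x. f x = 0}"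
    and M: "complex_vector.subspace M" "finite_cdim M"
  shows "finite_cdim {x. f x \<in> M}"
proof -
  let ?P = "{x. f x \<in> M}"
  have P: "complex_vector.subspace ?P"
    using clinear.linear_subspace_vimage[OF f M(1)] by (simp add: vimage_def)
  obtain B where B: "finite B" "M = complex_vector.span B"
    using M(2) unfolding finite_cdim_def by blast
  obtain K where K: "finite K" "{x. f x = 0} = complex_vector.span K"
    using ker unfolding finite_cdim_def by blast
  have "complex_vector.subspace (f ` ?P)"
    using clinear.linear_subspace_image[OF f P] .
  moreover have "f ` ?P \<subseteq> complex_vector.span B" using B by auto
  ultimately obtain C where C: "finite C" "C \<subseteq> f ` ?P" "f ` ?P = complex_vector.span C"
    using finite_cdim_subspace B(1) by metis
  obtain D where D: "finite D" "C = f ` D"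
    using C(1,2) by (meson finite_subset_image)
  have "x \<in> complex_vector.span (D \<union> K)" if "x \<in> ?P" for x
  proof -
    have "f x \<in> f ` complex_vector.span D"
      using that C(3) D(2) clinear.linear_span_image[OF f] by blast
    then obtain d where d: "d \<in> complex_vector.span D" "f x = f d" by blast
    hence "x - d \<in> complex_vector.span K"
      using clinear.linear_diff[OF f, of x d] K(2) by auto
    hence "d + (x - d) \<in> complex_vector.span (D \<union> K)"
      using d(1) complex_vector.span_Un[of D K] by blast
    thus ?thesis by simp
  qed
  moreover have "finite_cdim (complex_vector.span (D \<union> K))"
    unfolding finite_cdim_def using D(1) K(1) by blast
  ultimately show ?thesis using finite_cdim_mono[OF _ P] by blast
qed

lemma decseq_subspace_stabilizes:
  fixes V :: "nat \<Rightarrow> 'a::complex_vector set"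
  assumes sub: "\<And>k. complex_vector.subspace (V k)" and dec: "decseq V" and fd: "finite_cdim (V 0)"
  obtains k where "\<And>j. j \<ge> k \<Longrightarrow> V j = V k"
proof -
  have "\<exists>C. finite C \<and> complex_vector.independent C \<and> V k = complex_vector.span C" for k
    using finite_cdim_subspace[OF sub, of k] fd decseqD[OF dec, of 0 k]
    unfolding finite_cdim_def by (metis zero_le)
  then obtain C where C: "\<And>k. finite (C k)" "\<And>k. complex_vector.independent (C k)"
    "\<And>k. V k = complex_vector.span (C k)" by metis
  \<comment> \<open>Take \<open>k\<close> of least dimension. A vector of \<open>C k\<close> outside
    \<open>V j\<close>, added to \<open>C j\<close>, would stay independent inside
    \<open>V k\<close>, forcing \<open>V j\<close> to have smaller dimension.\<close>
  obtain k where k: "\<And>j. card (C k) \<le> card (C j)"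
    using exists_least_iff[of "\<lambda>n. \<exists>k. n = card (C k)"] by (metis linorder_not_less)
  have "V k \<subseteq> V j" if "j \<ge> k" for j
  proof (rule ccontr)
    assume "\<not> V k \<subseteq> V j"
    hence "\<not> C k \<subseteq> V j" using C(3) sub complex_vector.span_minimal by metis
    then obtain x where x: "x \<in> C k" "x \<notin> complex_vector.span (C j)" using C(3) by blast
    have "complex_vector.independent (insert x (C j))"
      using x(2) C(2) complex_vector.independent_insertI by blast
    moreover have "insert x (C j) \<subseteq> complex_vector.span (C k)"
      using x(1) decseqD[OF dec that] C(3) complex_vector.span_superset by blast
    ultimately have "card (insert x (C j)) \<le> card (C k)"
      using complex_vector.independent_span_bound[OF C(1)] by blast
    moreover have "x \<notin> C j" using x(2) complex_vector.span_base by blast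
    ultimately show False using k[of j] C(1)[of j] by simp
  qed
  thus thesis using that decseqD[OF dec] by blast
qed

section \<open>Generalized eigenvectors\<close>

abbreviation shifted :: "('a::complex_vector \<Rightarrow> 'a) \<Rightarrow> complex \<Rightarrow> 'a \<Rightarrow> 'a" where
  "shifted T a \<equiv> (\<lambda>x. T x - a *\<^sub>C x)"

text \<open>No bound on the exponent; that one power suffices is shown later when the eigenspace is
  finite-dimensional and the adjoint is triangular.\<close>

definition gen_eigenspace :: "('a::complex_vector \<Rightarrow> 'a) \<Rightarrow> complex \<Rightarrow> 'a set" where
  "gen_eigenspace T a = {x. \<exists>k. (shifted T a ^^ k) x = 0}"

lemma clinear_shifted:
  assumes "clinear T" shows "clinear (shifted T a)"
  using clinear.linear_add[OF assms] clinear.linear_scale[OF assms]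
  by (intro clinearI) (auto simp: complex_vector.scale_right_distrib
      complex_vector.scale_right_diff_distrib mult.commute)

lemma clinear_funpow:
  fixes T :: "'a::complex_vector \<Rightarrow> 'a"
  assumes "clinear T" shows "clinear (T ^^ k)"
proof (induction k)
  case 0 show ?case by (rule clinearI) auto
next
  case (Suc k) thus ?case
    using clinear.linear_add[OF assms] clinear.linear_scale[OF assms]
      clinear.linear_add[OF Suc] clinear.linear_scale[OF Suc]
    by (intro clinearI) auto
qed

lemma subspace_ker:
  assumes "clinear f" shows "complex_vector.subspace {x. f x = (0::'a::complex_vector)}"
  using clinear.linear_subspace_vimage[OF assms complex_vector.subspace_single_0]
  by (simp add: vimage_def)

lemma funpow_eq_0_mono:
  assumes "clinear f" "(f ^^ k) x = (0::'a::complex_vector)" "k \<le> n"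
  shows "(f ^^ n) x = 0"
  using assms clinear.linear_0[OF clinear_funpow[OF assms(1), of "n - k"]]
    funpow_add[of "n - k" k f] by simp

lemma subspace_gen_eigenspace:
  assumes T: "clinear T" shows "complex_vector.subspace (gen_eigenspace T a)"
proof (rule complex_vector.subspaceI)
  let ?N = "shifted T a"
  note lin = clinear_funpow[OF clinear_shifted[OF T, of a]]
  show "0 \<in> gen_eigenspace T a" unfolding gen_eigenspace_def by (auto intro: exI[of _ 0])
  fix x y assume "x \<in> gen_eigenspace T a" "y \<in> gen_eigenspace T a"
  then obtain k n where "(?N ^^ k) x = 0" "(?N ^^ n) y = 0" unfolding gen_eigenspace_def by blast
  hence "(?N ^^ (max k n)) x = 0" "(?N ^^ (max k n)) y = 0"
    using funpow_eq_0_mono[OF clinear_shifted[OF T]]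
    by (meson max.cobounded1 max.cobounded2)+
  hence "(?N ^^ (max k n)) (x + y) = 0" using clinear.linear_add[OF lin] by simp
  thus "x + y \<in> gen_eigenspace T a" unfolding gen_eigenspace_def by blast
next
  fix c x assume "x \<in> gen_eigenspace T a"
  thus "c *\<^sub>C x \<in> gen_eigenspace T a"
    unfolding gen_eigenspace_def
    using clinear.linear_scale[OF clinear_funpow[OF clinear_shifted[OF T, of a]]] by fastforce
qed

text \<open>On vectors killed by a power of \<open>T - b\<close>, the operator
  \<open>T - a = (T - b) + (b - a)\<close> is nilpotent plus a nonzero scalar, hence invertible;
  induction on the exponent builds the preimage without leaving the generalized eigenspace.\<close>

lemma shifted_onto_ker_funpow:
  assumes T: "clinear T" and "b \<noteq> a" and "(shifted T b ^^ k) x = 0"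
  shows "\<exists>h. h \<in> gen_eigenspace T b \<and> x = shifted T a h"
  using assms(3)
proof (induction k arbitrary: x)
  case 0
  thus ?case using complex_vector.subspace_0[OF subspace_gen_eigenspace[OF T]]
      clinear.linear_0[OF T] by (intro exI[of _ 0]) auto
next
  case (Suc k)
  note sub = subspace_gen_eigenspace[OF T, of b]
  have "(shifted T b ^^ k) (shifted T b x) = 0"
    using Suc.prems by (simp add: funpow_Suc_right del: funpow.simps)
  then obtain h where h: "h \<in> gen_eigenspace T b" "shifted T b x = shifted T a h"
    using Suc.IH by blast
  have x: "x \<in> gen_eigenspace T b" using Suc.prems unfolding gen_eigenspace_def by blast
  \<comment> \<open>Since \<open>(T - a) h = (T - b) x\<close>, the difference
    \<open>(T - a) x - (T - a) h\<close> is \<open>(b - a) x\<close>, so dividing by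
    \<open>b - a\<close> gives a preimage of \<open>x\<close>.\<close>
  let ?g = "inverse (b - a) *\<^sub>C (x - h)"
  have "?g \<in> gen_eigenspace T b"
    using x h(1) sub complex_vector.subspace_diff complex_vector.subspace_scale by blast
  moreover have "shifted T a ?g = inverse (b - a) *\<^sub>C (shifted T a x - shifted T a h)"
    using clinear.linear_scale[OF clinear_shifted[OF T, of a]]
      clinear.linear_diff[OF clinear_shifted[OF T, of a]] by simp
  moreover have "shifted T a x - shifted T a h = (b - a) *\<^sub>C x"
    unfolding h(2)[symmetric] by (simp add: complex_vector.scale_left_diff_distrib)
  ultimately show ?case using \<open>b \<noteq> a\<close> by (intro exI[of _ ?g]) simp
qed

text \<open>Algebraic span, without closure: back substitution solves equations exactly with
  finitely many generalized eigenvectors.\<close>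

definition gen_eigenspan :: "('a::complex_vector \<Rightarrow> 'a) \<Rightarrow> 'a set" where
  "gen_eigenspan T = complex_vector.span (\<Union>a. gen_eigenspace T a)"

text \<open>\<open>T - a\<close> covers every generalized eigenspace for
  \<open>b \<noteq> a\<close>, so modulo the one for \<open>a\<close> each vector of the span is
  \<open>(T - a) h\<close> with \<open>h\<close> in the span. Subtracting \<open>h\<close> from
  \<open>x\<close> leaves a generalized eigenvector for \<open>a\<close>.\<close>

lemma gen_eigenspan_shifted:
  assumes T: "clinear T" and x: "shifted T a x \<in> gen_eigenspan T"
  shows "x \<in> gen_eigenspan T"
proof -
  let ?N = "shifted T a"
  note N = clinear_shifted[OF T, of a]
  let ?S = "{u + v | u v. u \<in> ?N ` gen_eigenspan T \<and> v \<in> gen_eigenspace T a}"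
  have sub: "complex_vector.subspace (gen_eigenspan T)" unfolding gen_eigenspan_def by simp
  have gen: "gen_eigenspace T b \<subseteq> gen_eigenspan T" for b
    unfolding gen_eigenspan_def by (rule order_trans[OF _ complex_vector.span_superset]) auto
  have "complex_vector.subspace ?S"
    by (intro complex_vector.subspace_sums clinear.linear_subspace_image[OF N] sub
        subspace_gen_eigenspace[OF T])
  moreover have "(\<Union>b. gen_eigenspace T b) \<subseteq> ?S"
  proof
    fix g assume "g \<in> (\<Union>b. gen_eigenspace T b)"
    then obtain b where b: "g \<in> gen_eigenspace T b" by blast
    have "?N 0 = 0" using clinear.linear_0[OF N] .
    hence N0: "0 \<in> ?N ` gen_eigenspan T"
      using complex_vector.subspace_0[OF sub] by (intro image_eqI[of _ _ 0]) auto
    show "g \<in> ?S"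
    proof (cases "b = a")
      case True
      thus ?thesis using b N0 by (intro CollectI exI[of _ 0] exI[of _ g]) simp
    next
      case False
      obtain k where "(shifted T b ^^ k) g = 0" using b unfolding gen_eigenspace_def by blast
      then obtain h where h: "h \<in> gen_eigenspace T b" "g = ?N h"
        using shifted_onto_ker_funpow[OF T False] by blast
      hence "g \<in> ?N ` gen_eigenspan T" using gen by blast
      moreover have "0 \<in> gen_eigenspace T a"
        using complex_vector.subspace_0[OF subspace_gen_eigenspace[OF T]] .
      ultimately show ?thesis by (intro CollectI exI[of _ g] exI[of _ 0]) simp
    qed
  qed
  ultimately have "complex_vector.span (\<Union>b. gen_eigenspace T b) \<subseteq> ?S"
    by (intro complex_vector.span_minimal)
  hence "gen_eigenspan T \<subseteq> ?S" by (simp only: gen_eigenspan_def)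
  then obtain h v where h: "h \<in> gen_eigenspan T" "v \<in> gen_eigenspace T a" "?N x = ?N h + v"
    using x by blast
  have v: "?N (x - h) = v" using clinear.linear_diff[OF N, of x h] h(3) by simp
  obtain k where "(?N ^^ k) v = 0" using h(2) unfolding gen_eigenspace_def by blast
  \<comment> \<open>One power more than for \<open>v\<close>, because \<open>v\<close> is itself
    \<open>(T - a) (x - h)\<close>.\<close>
  hence "(?N ^^ Suc k) (x - h) = 0" using v by (simp add: funpow_Suc_right del: funpow.simps)
  hence "x - h \<in> gen_eigenspace T a" unfolding gen_eigenspace_def by blast
  hence "x - h \<in> gen_eigenspan T" using gen by blast
  hence "(x - h) + h \<in> gen_eigenspan T" using h(1) sub complex_vector.subspace_add by blast
  thus ?thesis by simp
qed

section \<open>Complex inner product spaces\<close>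

lemma cinner_add_right: "cinner x (y + z) = cinner x y + cinner x z" for x :: "'a::complex_inner"
  using cinner_commute cinner_add_left by (metis complex_cnj_add)

lemma cinner_scaleC_right: "cinner x (c *\<^sub>C y) = cnj c * cinner x y" for x :: "'a::complex_inner"
  using cinner_commute cinner_scaleC_left by (metis complex_cnj_mult)

lemma cinner_0_left [simp]: "cinner 0 y = 0" for y :: "'a::complex_inner"
  using cinner_add_left[of 0 0 y] by simp

lemma cinner_0_right [simp]: "cinner y 0 = 0" for y :: "'a::complex_inner"
  using cinner_add_right[of y 0 0] by simp

lemma cinner_diff_left: "cinner (x - y) z = cinner x z - cinner y z" for x :: "'a::complex_inner"
  using cinner_add_left[of "x - y" y z] by simp

lemma cinner_diff_right: "cinner x (y - z) = cinner x y - cinner x z" for x :: "'a::complex_inner"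
  using cinner_add_right[of x "y - z" z] by simp

lemma cinner_sum_left: "cinner (\<Sum>i\<in>I. f i) z = (\<Sum>i\<in>I. cinner (f i) z)" for z :: "'a::complex_inner"
  by (induction I rule: infinite_finite_induct) (auto simp: cinner_add_left)

lemma cinner_self_eq_0: "cinner x x = 0 \<longleftrightarrow> x = 0" for x :: "'a::complex_inner"
  by (simp add: cinner_self_eq_norm)

lemma norm_scaleC: "norm (c *\<^sub>C x) = cmod c * norm x" for x :: "'a::complex_inner"
proof -
  have "complex_of_real ((norm (c *\<^sub>C x))\<^sup>2) = complex_of_real ((cmod c * norm x)\<^sup>2)"
    unfolding cinner_self_eq_norm[symmetric] cinner_scaleC_left cinner_scaleC_right
    by (simp only: cinner_self_eq_norm power_mult_distrib mult.assoc[symmetric]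
        complex_norm_square[symmetric] of_real_mult mult.commute[of "cnj c"])
  hence "(norm (c *\<^sub>C x))\<^sup>2 = (cmod c * norm x)\<^sup>2" using of_real_eq_iff by blast
  thus ?thesis by (simp add: power2_eq_iff_nonneg)
qed

lemma bounded_linear_scaleC: "bounded_linear (\<lambda>x::'a::complex_inner. c *\<^sub>C x)"
  by (rule bounded_linear_intro[of _ "cmod c"])
    (auto simp: complex_vector.scale_right_distrib scaleR_scaleC norm_scaleC mult.commute)

text \<open>Conjugate linearity recovers the imaginary part from the real inner product, so
  continuity of \<open>cinner\<close> reduces to that of \<open>inner\<close>.\<close>

lemma cinner_eq_inner:
  "cinner x y = of_real (inner x y) + \<i> * of_real (inner x (\<i> *\<^sub>C y))" for x :: "'a::complex_inner"
  by (simp add: inner_eq_Re_cinner cinner_scaleC_right complex_eq_iff)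

lemma bounded_linear_cinner_left: "bounded_linear (\<lambda>x::'a::complex_inner. cinner x y)"
  unfolding cinner_eq_inner
  by (intro bounded_linear_add bounded_linear_compose[OF bounded_linear_mult_right]
      bounded_linear_compose[OF bounded_linear_of_real] bounded_linear_inner_left)

lemma continuous_on_cinner_left: "continuous_on S (\<lambda>x::'a::complex_inner. cinner x y)"
  using linear_continuous_on[OF bounded_linear_cinner_left] .

lemma subspace_cinner_eq_0: "complex_vector.subspace {x::'a::complex_inner. cinner x y = 0}"
  by (rule complex_vector.subspaceI) (auto simp: cinner_add_left cinner_scaleC_left)

text \<open>The kernel of a continuous linear functional is a closed subspace; this carries
  orthogonality from generators to their closed span.\<close>

lemma cinner_closure_span_eq_0:
  fixes y :: "'a::complex_inner"
  assumes "\<And>x. x \<in> X \<Longrightarrow> cinner x y = 0" "x \<in> closure (complex_vector.span X)"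
  shows "cinner x y = 0"
proof -
  have "complex_vector.span X \<subseteq> {x. cinner x y = 0}"
    using assms(1) subspace_cinner_eq_0 by (intro complex_vector.span_minimal) auto
  moreover have "closed {x. cinner x y = 0}"
    using continuous_on_cinner_left by (intro closed_Collect_eq) auto
  ultimately show ?thesis using assms(2) closure_minimal by blast
qed

lemma subspace_closure:
  fixes S :: "'a::complex_inner set"
  assumes S: "complex_vector.subspace S" shows "complex_vector.subspace (closure S)"
proof (rule complex_vector.subspaceI)
  show "0 \<in> closure S" using complex_vector.subspace_0[OF S] closure_subset by blast
next
  fix x y assume "x \<in> closure S" "y \<in> closure S"
  then obtain f g where f: "\<forall>n. f n \<in> S" "f \<longlonglongrightarrow> x" and g: "\<forall>n. g n \<in> S" "g \<longlonglongrightarrow> y"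
    unfolding closure_sequential by blast
  have "\<forall>n. f n + g n \<in> S" using f g complex_vector.subspace_add[OF S] by blast
  thus "x + y \<in> closure S" unfolding closure_sequential
    using tendsto_add[OF f(2) g(2)] by (intro exI[of _ "\<lambda>n. f n + g n"]) simp
next
  fix c x assume "x \<in> closure S"
  then obtain f where f: "\<forall>n. f n \<in> S" "f \<longlonglongrightarrow> x" unfolding closure_sequential by blast
  have "\<forall>n. c *\<^sub>C f n \<in> S" using f complex_vector.subspace_scale[OF S] by blast
  thus "c *\<^sub>C x \<in> closure S" unfolding closure_sequential
    using bounded_linear.tendsto[OF bounded_linear_scaleC f(2)]
    by (intro exI[of _ "\<lambda>n. c *\<^sub>C f n"]) simp
qed

lemma closure_span_base: "x \<in> X \<Longrightarrow> x \<in> closure (complex_vector.span X)"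
  using closure_subset complex_vector.span_base by (rule subsetD)

lemma closed_csubspace_closure_span: "closed_csubspace (closure (complex_vector.span X))"
  unfolding closed_csubspace_def by (simp add: subspace_closure)

section \<open>Infinite dimension and codimension from orthogonality\<close>

lemma infinite_even: "infinite {n::nat. even n}"
  unfolding infinite_nat_iff_unbounded_le
proof
  show "\<exists>n\<ge>m. n \<in> {n. even n}" for m :: nat by (rule exI[of _ "2 * m"]) simp
qed

lemma infinite_odd: "infinite {n::nat. odd n}"
  unfolding infinite_nat_iff_unbounded_le
proof
  show "\<exists>n\<ge>m. n \<in> {n. odd n}" for m :: nat by (rule exI[of _ "2 * m + 1"]) simp
qed

text \<open>Pairing with \<open>y i\<close> annihilates every other \<open>x j\<close> but not
  \<open>x i\<close>, so the \<open>x i\<close> are distinct and linearly independent.\<close>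

lemma infinite_cdim_biorthogonal:
  fixes x y :: "'i \<Rightarrow> 'a::complex_inner"
  assumes I: "infinite I" and "\<And>i. i \<in> I \<Longrightarrow> cinner (x i) (y i) \<noteq> 0"
    and "\<And>i j. i \<in> I \<Longrightarrow> j \<in> I \<Longrightarrow> i \<noteq> j \<Longrightarrow> cinner (x i) (y j) = 0"
    and sub: "\<And>i. i \<in> I \<Longrightarrow> x i \<in> M"
  shows "\<not> finite_cdim M"
proof
  assume "finite_cdim M"
  then obtain B where B: "finite B" "M = complex_vector.span B" unfolding finite_cdim_def by blast
  have inj: "inj_on x I" using assms by (metis inj_onI)
  have "complex_vector.independent (x ` I)"
    unfolding complex_vector.dependent_def
  proof clarify
    fix i assume i: "i \<in> I" "x i \<in> complex_vector.span (x ` I - {x i})"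
    hence "cinner (x i) (y i) = 0"
      using assms(3) closure_subset by - (rule cinner_closure_span_eq_0[of "x ` I - {x i}"]; auto)
    thus False using assms(2) i by blast
  qed
  hence "finite (x ` I)"
    using complex_vector.independent_span_bound[OF B(1)] sub B(2) by blast
  thus False using I inj finite_imageD by blast
qed

text \<open>Each condition \<open>cinner y b = 0\<close> lowers the dimension by at most
  one.\<close>

lemma infinite_cdim_orthogonal_finite:
  fixes S :: "'a::complex_inner set"
  assumes S: "complex_vector.subspace S" "\<not> finite_cdim S" and B: "finite B"
  shows "\<not> finite_cdim {y \<in> S. \<forall>b\<in>B. cinner y b = 0}"
  using B
proof (induction B)
  case empty thus ?case using S by simp
next
  case (insert b B)
  let ?V = "{y \<in> S. \<forall>b\<in>B. cinner y b = 0}"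
  let ?W = "{y \<in> S. \<forall>b\<in>insert b B. cinner y b = 0}"
  have V: "complex_vector.subspace ?V"
    using complex_vector.subspace_0[OF S(1)] complex_vector.subspace_add[OF S(1)]
      complex_vector.subspace_scale[OF S(1)]
    by (intro complex_vector.subspaceI) (auto simp: cinner_add_left cinner_scaleC_left)
  show ?case
  proof
    assume W: "finite_cdim ?W"
    \<comment> \<open>\<open>s\<close> is a vector of \<open>?V\<close> not orthogonal to
      \<open>b\<close> if there is one, and 0 otherwise, when \<open>?W\<close> is all of
      \<open>?V\<close>.\<close>
    have "\<exists>s. \<forall>x\<in>?V. \<exists>c. x - c *\<^sub>C s \<in> ?W"
    proof (cases "\<exists>s\<in>?V. cinner s b \<noteq> 0")
      case True
      then obtain s where s: "s \<in> ?V" "cinner s b \<noteq> 0" by blast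
      have "x - (cinner x b / cinner s b) *\<^sub>C s \<in> ?W" if "x \<in> ?V" for x
      proof -
        have "x - (cinner x b / cinner s b) *\<^sub>C s \<in> ?V"
          using that s(1) V complex_vector.subspace_diff complex_vector.subspace_scale by blast
        thus ?thesis using s(2) by (auto simp: cinner_diff_left cinner_scaleC_left)
      qed
      thus ?thesis by blast
    next
      case False
      thus ?thesis by (intro exI[of _ 0]) auto
    qed
    hence "finite_cdim ?V" using finite_cdim_insert[OF W _ V] by meson
    thus False using insert.IH by blast
  qed
qed

text \<open>If a finite \<open>B\<close> completed \<open>M\<close> to the whole space, only 0 would
  be orthogonal to both; yet an infinite-dimensional orthogonal complement of \<open>M\<close> stays
  infinite-dimensional after imposing orthogonality to \<open>B\<close>.\<close>

lemma infinite_ccodimI: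
  fixes M :: "'a::complex_inner set"
  assumes "\<not> finite_cdim {y. \<forall>x\<in>M. cinner x y = 0}"
  shows "\<not> finite_ccodim M"
proof
  assume "finite_ccodim M"
  then obtain B where B: "finite B" "complex_vector.span (M \<union> B) = UNIV"
    unfolding finite_ccodim_def by blast
  let ?P = "{y. \<forall>x\<in>M. cinner x y = 0}"
  have "complex_vector.subspace ?P"
    by (rule complex_vector.subspaceI) (auto simp: cinner_add_right cinner_scaleC_right)
  hence "\<not> finite_cdim {y \<in> ?P. \<forall>b\<in>B. cinner y b = 0}"
    using infinite_cdim_orthogonal_finite assms B(1) by blast
  moreover have "{y \<in> ?P. \<forall>b\<in>B. cinner y b = 0} = {0}"
  proof -
    have "y = 0" if "y \<in> ?P" "\<forall>b\<in>B. cinner y b = 0" for y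
    proof -
      have "cinner b y = 0" if "b \<in> B" for b
        using that \<open>\<forall>b\<in>B. cinner y b = 0\<close> cinner_commute[of b y] by simp
      hence "cinner y y = 0"
        using that(1) B(2) by - (rule cinner_closure_span_eq_0[of "M \<union> B" y]; auto)
      thus ?thesis by (simp add: cinner_self_eq_0)
    qed
    thus ?thesis by auto
  qed
  moreover have "finite_cdim {0::'a}"
    unfolding finite_cdim_def using complex_vector.span_empty by (metis finite.emptyI)
  ultimately show False by simp
qed

section \<open>Orthonormal bases and triangular operators\<close>

lemma orthonormal_basis_cinner:
  "orthonormal_basis e \<Longrightarrow> cinner (e i) (e j) = (if i = j then 1 else 0)"
  unfolding orthonormal_basis_def by blast

lemma orthonormal_basis_complete:
  fixes e :: "nat \<Rightarrow> 'a::complex_inner"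
  assumes e: "orthonormal_basis e" and "\<And>n. cinner (e n) y = 0"
  shows "y = 0"
proof -
  have "cinner y y = 0"
    using assms unfolding orthonormal_basis_def
    by - (rule cinner_closure_span_eq_0[of "range e"]; auto)
  thus ?thesis by (simp add: cinner_self_eq_0)
qed

text \<open>Back substitution: \<open>T - c n\<close> sends \<open>e n\<close> into the span of the
  earlier basis vectors, which are already reached by induction, and solving for \<open>e n\<close>
  does not leave \<open>gen_eigenspan T\<close>.\<close>

lemma gen_eigenspan_triangular_basis:
  fixes T :: "'a::complex_inner \<Rightarrow> 'a"
  assumes T: "clinear T" and e: "orthonormal_basis e"
    and tri: "\<And>i j. i > j \<Longrightarrow> cinner (T (e j)) (e i) = 0"
  shows "e n \<in> gen_eigenspan T"
proof (induction n rule: less_induct)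
  case (less n)
  define c where "c i = cinner (T (e n)) (e i)" for i
  \<comment> \<open>Orthogonality holds for \<open>k \<le> n\<close> by the choice of coefficients
    and for \<open>k > n\<close> by triangularity, so \<open>T (e n)\<close> is a finite
    sum.\<close>
  have "cinner (T (e n) - (\<Sum>i\<le>n. c i *\<^sub>C e i)) (e k) = 0" for k
    using tri[of n k] by (simp add: c_def cinner_diff_left cinner_sum_left cinner_scaleC_left
        orthonormal_basis_cinner[OF e] if_distrib cong: if_cong)
  hence "cinner (e k) (T (e n) - (\<Sum>i\<le>n. c i *\<^sub>C e i)) = 0" for k
    using cinner_commute by (metis complex_cnj_zero)
  hence "T (e n) - (\<Sum>i\<le>n. c i *\<^sub>C e i) = 0"
    using orthonormal_basis_complete[OF e] by blast
  hence "T (e n) = (\<Sum>i<n. c i *\<^sub>C e i) + c n *\<^sub>C e n"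
    unfolding lessThan_Suc_atMost[symmetric] sum.lessThan_Suc by (simp only: right_minus_eq)
  hence "shifted T (c n) (e n) = (\<Sum>i<n. c i *\<^sub>C e i)"
    by (metis add_diff_cancel_right')
  moreover have "(\<Sum>i<n. c i *\<^sub>C e i) \<in> gen_eigenspan T"
    using less.IH unfolding gen_eigenspan_def
    by (intro complex_vector.span_sum complex_vector.span_scale) auto
  ultimately have "shifted T (c n) (e n) \<in> gen_eigenspan T" by simp
  thus ?case by (rule gen_eigenspan_shifted[OF T])
qed

lemma triangular_gen_eigenspan:
  fixes T :: "'a::complex_inner \<Rightarrow> 'a"
  assumes "clinear T" "triangular T"
  obtains e where "orthonormal_basis e" "range e \<subseteq> gen_eigenspan T"
proof -
  obtain e where e: "orthonormal_basis e" "\<forall>i j. i > j \<longrightarrow> cinner (T (e j)) (e i) = 0"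
    using assms(2) unfolding triangular_def by blast
  have "e n \<in> gen_eigenspan T" for n
    using e(2) by (intro gen_eigenspan_triangular_basis[OF assms(1) e(1)]) simp
  hence "range e \<subseteq> gen_eigenspan T" by blast
  with e(1) show thesis by (rule that)
qed

text \<open>An orthonormal basis gives the representing vector directly as \<open>\<Sum>n. cnj (f (e n)) e n\<close>,
  so no projection theorem is needed.\<close>

lemma riesz_representation:
  fixes f :: "'a::complex_hilbert_space \<Rightarrow> complex"
  assumes e: "orthonormal_basis (e :: nat \<Rightarrow> 'a)" and f: "bounded_linear f"
    and scale: "\<And>c x. f (c *\<^sub>C x) = c * f x"
  shows "\<exists>r. \<forall>x. f x = cinner x r"
proof -
  define s where "s n = (\<Sum>i<n. cnj (f (e i)) *\<^sub>C e i)" for n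
  define q where "q n = (\<Sum>i<n. (cmod (f (e i)))\<^sup>2)" for n
  have inner_e: "inner (c *\<^sub>C e i) (d *\<^sub>C e j) = (if i = j then Re (c * cnj d) else 0)" for c d i j
    by (simp add: inner_eq_Re_cinner cinner_scaleC_left cinner_scaleC_right orthonormal_basis_cinner[OF e])
  \<comment> \<open>Pythagoras: convergence of the vectors \<open>s\<close> reduces to that of the
    real sequence \<open>q\<close>.\<close>
  have diff: "(norm (s n - s m))\<^sup>2 = q n - q m" if "m \<le> n" for m n
  proof -
    have "s n - s m = (\<Sum>i\<in>{m..<n}. cnj (f (e i)) *\<^sub>C e i)"
      using that unfolding s_def by (simp add: sum_diff_nat_ivl lessThan_atLeast0)
    hence "(norm (s n - s m))\<^sup>2 = (\<Sum>i\<in>{m..<n}. Re (cnj (f (e i)) * f (e i)))"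
      by (simp add: power2_norm_eq_inner inner_sum_left inner_sum_right inner_e)
    also have "\<dots> = (\<Sum>i\<in>{m..<n}. (cmod (f (e i)))\<^sup>2)"
      by (intro sum.cong refl) (simp only: cmod_power2, simp add: power2_eq_square)
    also have "\<dots> = q n - q m"
      using that unfolding q_def by (simp add: sum_diff_nat_ivl lessThan_atLeast0)
    finally show ?thesis .
  qed
  obtain K where K: "K > 0" "\<And>x. norm (f x) \<le> norm x * K"
    using bounded_linear.pos_bounded[OF f] by blast
  \<comment> \<open>Evaluating \<open>f\<close> on \<open>s n\<close> gives \<open>q n\<close>, the
    square of \<open>norm (s n)\<close>; the bound on \<open>f\<close> then forces
    \<open>norm (s n) \<le> K\<close>.\<close>
  have q_le: "q n \<le> K\<^sup>2" for n
  proof -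
    have norm_s: "(norm (s n))\<^sup>2 = q n" using diff[of 0 n] by (simp add: s_def q_def)
    have "f (s n) = (\<Sum>i<n. cnj (f (e i)) * f (e i))"
      unfolding s_def by (simp add: linear_sum[OF bounded_linear.linear[OF f]] scale)
    also have "\<dots> = of_real (q n)"
      unfolding q_def of_real_sum
      by (intro sum.cong refl) (simp only: complex_norm_square mult.commute)
    finally have "cmod (f (s n)) = (norm (s n))\<^sup>2" using norm_s by (metis norm_of_real abs_power2)
    hence "(norm (s n))\<^sup>2 \<le> norm (s n) * K" using K(2) by metis
    hence "norm (s n) \<le> K"
      using K(1) by (cases "norm (s n) = 0") (auto simp: power2_eq_square)
    thus ?thesis using norm_s power_mono[of "norm (s n)" K 2] by simp
  qed
  have "incseq q" unfolding q_def by (intro incseq_SucI) simp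
  hence "Cauchy q" using q_le incseq_convergent[of q] LIMSEQ_imp_Cauchy by metis
  have "Cauchy s"
  proof (rule CauchyI')
    fix r :: real assume "r > 0"
    then obtain N where N: "\<And>m n. m \<ge> N \<Longrightarrow> n \<ge> N \<Longrightarrow> \<bar>q m - q n\<bar> < r\<^sup>2"
      using \<open>Cauchy q\<close> unfolding Cauchy_iff by (metis real_norm_def zero_less_power)
    have "norm (s m - s n) < r" if "m \<ge> N" "n > m" for m n
    proof -
      have "(norm (s m - s n))\<^sup>2 < r\<^sup>2"
        using diff[of m n] N[of n m] that by (simp add: norm_minus_commute)
      thus ?thesis using \<open>r > 0\<close> power2_less_imp_less less_imp_le by blast
    qed
    thus "\<exists>M. \<forall>m\<ge>M. \<forall>n>m. dist (s m) (s n) < r" by (auto simp: dist_norm)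
  qed
  then obtain r where r: "s \<longlonglongrightarrow> r" using Cauchy_convergent_iff convergentD by blast
  have re: "cinner r (e k) = cnj (f (e k))" for k
  proof -
    have "(\<lambda>n. cinner (s n) (e k)) \<longlonglongrightarrow> cinner r (e k)"
      using bounded_linear.tendsto[OF bounded_linear_cinner_left r] .
    \<comment> \<open>The \<open>k\<close>-th coefficient is present from \<open>n = k + 1\<close>
      on, since \<open>s n\<close> sums over \<open>i < n\<close>.\<close>
    moreover have "eventually (\<lambda>n. cinner (s n) (e k) = cnj (f (e k))) sequentially"
      by (rule eventually_sequentiallyI[of "Suc k"])
        (simp add: s_def cinner_sum_left cinner_scaleC_left orthonormal_basis_cinner[OF e]
          if_distrib cong: if_cong)
    hence "(\<lambda>n. cinner (s n) (e k)) \<longlonglongrightarrow> cnj (f (e k))" by (rule tendsto_eventually)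
    ultimately show ?thesis using LIMSEQ_unique by blast
  qed
  \<comment> \<open>Both functionals are continuous and linear and agree on the basis, hence
    everywhere.\<close>
  let ?Z = "{x. f x = cinner x r}"
  have "cinner (e k) r = f (e k)" for k
    using re[of k] cinner_commute[of "e k" r] by simp
  hence "range e \<subseteq> ?Z" by auto
  moreover have "complex_vector.subspace ?Z"
    using linear_add[OF bounded_linear.linear[OF f]] linear_0[OF bounded_linear.linear[OF f]]
    by (intro complex_vector.subspaceI) (auto simp: scale cinner_add_left cinner_scaleC_left)
  ultimately have "complex_vector.span (range e) \<subseteq> ?Z" by (rule complex_vector.span_minimal)
  moreover have "closed ?Z"
    using continuous_on_cinner_left linear_continuous_on[OF f] by (intro closed_Collect_eq) auto
  ultimately have "closure (complex_vector.span (range e)) \<subseteq> ?Z" by (rule closure_minimal)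
  thus ?thesis using e unfolding orthonormal_basis_def by blast
qed

section \<open>Adjoints and the pairing of eigenspaces\<close>

lemma bounded_clinear_imp_clinear: "bounded_clinear T \<Longrightarrow> clinear T"
  unfolding bounded_clinear_def
  by (intro clinearI) (auto simp: linear_add bounded_linear.linear)

text \<open>\<open>cadjoint\<close> is a definite description, so its identity needs an adjoint to
  exist; representing the functionals \<open>cinner (T _) y\<close> supplies one.\<close>

lemma cinner_cadjoint:
  fixes T :: "'a::complex_hilbert_space \<Rightarrow> 'a"
  assumes e: "orthonormal_basis (e :: nat \<Rightarrow> 'a)" and T: "bounded_clinear T"
  shows "cinner (T x) y = cinner x (cadjoint T y)"
proof -
  have "\<exists>r. \<forall>x. cinner (T x) y = cinner x r" for y
    using T bounded_linear_compose[OF bounded_linear_cinner_left]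
    by (intro riesz_representation[OF e]) (auto simp: bounded_clinear_def cinner_scaleC_left)
  then obtain S where "\<And>x y. cinner (T x) y = cinner x (S y)" by metis
  thus ?thesis using cadjoint_eqI by metis
qed

lemma cinner_left_eqI:
  fixes y z :: "'a::complex_inner"
  assumes "\<And>x. cinner x y = cinner x z" shows "y = z"
proof -
  have "cinner (y - z) (y - z) = 0" using assms by (simp add: cinner_diff_right)
  thus ?thesis by (simp add: cinner_self_eq_0)
qed

lemma clinear_adjoint:
  fixes T S :: "'a::complex_inner \<Rightarrow> 'a"
  assumes "\<And>x y. cinner (T x) y = cinner x (S y)"
  shows "clinear S"
  by (intro clinearI cinner_left_eqI)
    (simp_all add: cinner_add_right cinner_scaleC_right flip: assms)

lemma cinner_shifted_funpow:
  fixes T S :: "'a::complex_inner \<Rightarrow> 'a"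
  assumes "\<And>x y. cinner (T x) y = cinner x (S y)"
  shows "cinner ((shifted T a ^^ k) x) y = cinner x ((shifted S (cnj a) ^^ k) y)"
proof (induction k arbitrary: x)
  case (Suc k)
  have "cinner ((shifted T a ^^ Suc k) x) y = cinner (shifted T a x) ((shifted S (cnj a) ^^ k) y)"
    by (simp add: funpow_Suc_right Suc.IH del: funpow.simps)
  thus ?case
    by (simp add: assms cinner_diff_left cinner_diff_right cinner_scaleC_left cinner_scaleC_right)
qed simp

text \<open>A power of \<open>T - b\<close>, moved across the inner product, kills \<open>y\<close>,
  while on \<open>x\<close> it acts as the nonzero scalar \<open>(a - b) ^ k\<close>.\<close>

lemma gen_eigenspace_orthogonal:
  fixes T S :: "'a::complex_inner \<Rightarrow> 'a"
  assumes adj: "\<And>x y. cinner (T x) y = cinner x (S y)"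
    and x: "T x = a *\<^sub>C x" and y: "y \<in> gen_eigenspace S (cnj b)" and "a \<noteq> b"
  shows "cinner x y = 0"
proof -
  obtain k where k: "(shifted S (cnj b) ^^ k) y = 0" using y unfolding gen_eigenspace_def by blast
  have "(shifted T b ^^ k) x = (a - b) ^ k *\<^sub>C x"
  proof (induction k)
    case 0 show ?case by simp
  next
    case (Suc k)
    \<comment> \<open>Linearity of \<open>T\<close> comes from the adjoint identity read backwards,
      with \<open>T\<close> as the adjoint of \<open>S\<close>.\<close>
    have "shifted T b ((a - b) ^ k *\<^sub>C x) = (a - b) ^ k *\<^sub>C shifted T b x"
      using clinear.linear_scale[OF clinear_shifted]
        clinear_adjoint[of S T] adj cinner_commute by (metis (no_types, lifting))
    thus ?case using Suc x
      by (simp add: complex_vector.scale_left_diff_distrib[symmetric] mult.commute)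
  qed
  hence "(a - b) ^ k * cinner x y = 0"
    using cinner_shifted_funpow[where T=T and S=S and a=b and k=k and x=x and y=y, OF adj] k
    by (simp add: cinner_scaleC_left)
  thus ?thesis using \<open>a \<noteq> b\<close> by simp
qed

text \<open>The span of the generalized eigenvectors contains an orthonormal basis, and only 0 is
  orthogonal to a basis.\<close>

lemma total_gen_eigenspan:
  fixes S :: "'a::complex_inner \<Rightarrow> 'a"
  assumes S: "clinear S" "triangular S" and x: "\<And>b y. y \<in> gen_eigenspace S b \<Longrightarrow> cinner x y = 0"
  shows "x = 0"
proof -
  obtain e where e: "orthonormal_basis e" "range e \<subseteq> gen_eigenspan S"
    using triangular_gen_eigenspan[OF S] by blast
  have "cinner y x = 0" if "y \<in> gen_eigenspan S" for y
  proof (rule cinner_closure_span_eq_0)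
    show "y \<in> closure (complex_vector.span (\<Union>a. gen_eigenspace S a))"
      using that closure_subset unfolding gen_eigenspan_def by blast
    show "cinner z x = 0" if "z \<in> (\<Union>a. gen_eigenspace S a)" for z
      using that x cinner_commute[of z x] by auto
  qed
  thus ?thesis using e orthonormal_basis_complete by blast
qed

text \<open>Generalized eigenvectors of \<open>S\<close> for eigenvalues other than
  \<open>cnj a\<close> are orthogonal to \<open>x\<close>, so by totality one for
  \<open>cnj a\<close> must detect it.\<close>

lemma eigenvector_not_orthogonal:
  fixes T S :: "'a::complex_inner \<Rightarrow> 'a"
  assumes adj: "\<And>x y. cinner (T x) y = cinner x (S y)" and S: "triangular S"
    and x: "T x = a *\<^sub>C x" "x \<noteq> 0"
  shows "\<exists>y \<in> gen_eigenspace S (cnj a). cinner x y \<noteq> 0"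
proof (rule ccontr)
  assume H: "\<not> ?thesis"
  have "cinner x y = 0" if "y \<in> gen_eigenspace S b" for b y
  proof (cases "a = cnj b")
    case True thus ?thesis using H that by auto
  next
    case False
    thus ?thesis using gen_eigenspace_orthogonal[of T S x a y "cnj b", OF adj x(1)] that by simp
  qed
  thus False using total_gen_eigenspan[OF clinear_adjoint[of T S, OF adj] S] x(2) by blast
qed

section \<open>Finite ascent and infinitely many eigenvalues\<close>

lemma finite_cdim_ker_funpow:
  assumes f: "clinear f" and ker: "finite_cdim {x. f x = 0}"
  shows "finite_cdim {x. (f ^^ k) x = 0}"
proof (induction k)
  case 0
  show ?case unfolding finite_cdim_def
    by (rule exI[of _ "{}"]) auto
next
  case (Suc k)
  have "{x. (f ^^ Suc k) x = 0} = {x. f x \<in> {x. (f ^^ k) x = 0}}"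
    by (simp add: funpow_Suc_right del: funpow.simps)
  thus ?case using finite_cdim_vimage[OF f ker subspace_ker[OF clinear_funpow[OF f]] Suc] by simp
qed

text \<open>The decreasing chain \<open>V\<close> of kernel vectors lying in ranges of powers
  becomes constant, and its final value is 0. From then on the kernels of powers stop growing, so
  one power gives the whole generalized eigenspace.\<close>

lemma finite_cdim_gen_eigenspace:
  fixes T S :: "'a::complex_inner \<Rightarrow> 'a"
  assumes T: "clinear T" and adj: "\<And>x y. cinner (T x) y = cinner x (S y)" and S: "triangular S"
    and ker: "finite_cdim {x. shifted T a x = 0}"
  shows "finite_cdim (gen_eigenspace T a)"
proof -
  let ?N = "shifted T a"
  define V where "V k = {x. ?N x = 0} \<inter> range (?N ^^ k)" for k
  note N = clinear_shifted[OF T, of a]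
  have sub: "complex_vector.subspace (V k)" for k
    unfolding V_def using subspace_ker[OF N]
      clinear.linear_subspace_image[OF clinear_funpow[OF N] complex_vector.subspace_UNIV]
    by (intro complex_vector.subspace_inter) auto
  have "range (?N ^^ Suc k) \<subseteq> range (?N ^^ k)" for k
    unfolding funpow_Suc_right by auto
  hence "decseq V" unfolding V_def by (intro decseq_SucI) blast
  moreover have "finite_cdim (V 0)" using ker unfolding V_def by simp
  ultimately obtain k where k: "\<And>j. j \<ge> k \<Longrightarrow> V j = V k"
    using decseq_subspace_stabilizes[of V] sub by metis
  have V0: "x = 0" if x: "x \<in> V k" for x
  proof (rule ccontr)
    assume "x \<noteq> 0"
    moreover have "T x = a *\<^sub>C x" using x unfolding V_def by simp
    ultimately obtain y where y: "y \<in> gen_eigenspace S (cnj a)" "cinner x y \<noteq> 0"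
      using eigenvector_not_orthogonal[of T S, OF adj S] by blast
    then obtain n where n: "(shifted S (cnj a) ^^ n) y = 0" unfolding gen_eigenspace_def by blast
    \<comment> \<open>Stability lets \<open>x\<close> be written with a power high enough to
      annihilate \<open>y\<close> on the adjoint side.\<close>
    have "x \<in> V (max k n)" using x k[of "max k n"] by simp
    then obtain z where "x = (?N ^^ max k n) z" unfolding V_def by blast
    moreover have "(shifted S (cnj a) ^^ max k n) y = 0"
      using funpow_eq_0_mono[OF clinear_shifted[OF clinear_adjoint[of T S, OF adj]] n] by simp
    ultimately show False using y(2) cinner_shifted_funpow[of T S, OF adj] by simp
  qed
  have "(?N ^^ k) x = 0" if "(?N ^^ n) x = 0" for n x
    using that
  proof (induction n)
    case 0 thus ?case using clinear.linear_0[OF clinear_funpow[OF N]] by simp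
  next
    case (Suc n)
    show ?case
    proof (cases "n < k")
      case True thus ?thesis using funpow_eq_0_mono[OF N Suc.prems, of k] by simp
    next
      case False
      \<comment> \<open>The vector lies in the kernel and in the range of the \<open>n\<close>-th
        power; for \<open>n \<ge> k\<close> that intersection is trivial, so the exponent drops by
        one.\<close>
      have "(?N ^^ n) x \<in> V n" using Suc.prems unfolding V_def by simp
      hence "(?N ^^ n) x = 0" using V0 k[of n] False by simp
      thus ?thesis by (rule Suc.IH)
    qed
  qed
  hence "gen_eigenspace T a = {x. (?N ^^ k) x = 0}" unfolding gen_eigenspace_def by blast
  thus ?thesis using finite_cdim_ker_funpow[OF N ker, of k] by simp
qed

text \<open>Finitely many eigenvalues would confine an orthonormal basis to a finite sum of
  finite-dimensional generalized eigenspaces.\<close>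

lemma infinite_eigenvalues:
  fixes T S :: "'a::complex_inner \<Rightarrow> 'a"
  assumes T: "clinear T" "triangular T" and adj: "\<And>x y. cinner (T x) y = cinner x (S y)"
    and S: "triangular S" and ker: "\<And>a. finite_cdim {x. shifted T a x = 0}"
  shows "infinite {a. \<exists>x. x \<noteq> 0 \<and> T x = a *\<^sub>C x}"
proof
  let ?L = "{a. \<exists>x. x \<noteq> 0 \<and> T x = a *\<^sub>C x}"
  assume fin: "finite ?L"
  obtain B where B: "\<And>a. finite (B a)" "\<And>a. gen_eigenspace T a = complex_vector.span (B a)"
    using finite_cdim_gen_eigenspace[of T S, OF T(1) adj S ker] unfolding finite_cdim_def by metis
  \<comment> \<open>For a non-eigenvalue, \<open>T - a\<close> and hence all its powers are
    injective.\<close>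
  have zero: "x = 0" if a: "a \<notin> ?L" and x: "x \<in> gen_eigenspace T a" for a x
  proof -
    have "x = 0" if "(shifted T a ^^ k) x = 0" for k
      using that
    proof (induction k)
      case (Suc k)
      hence "T ((shifted T a ^^ k) x) = a *\<^sub>C ((shifted T a ^^ k) x)" by simp
      thus ?case using a Suc.IH by blast
    qed simp
    thus ?thesis using x unfolding gen_eigenspace_def by blast
  qed
  let ?B = "\<Union>a\<in>?L. B a"
  have "gen_eigenspace T a \<subseteq> complex_vector.span ?B" for a
  proof (cases "a \<in> ?L")
    case True
    thus ?thesis unfolding B(2) by (intro complex_vector.span_mono) blast
  next
    case False
    thus ?thesis using zero complex_vector.span_zero by blast
  qed
  hence sub: "gen_eigenspan T \<subseteq> complex_vector.span ?B"
    unfolding gen_eigenspan_def by (intro complex_vector.span_minimal) auto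
  obtain e where e: "orthonormal_basis e" "range e \<subseteq> gen_eigenspan T"
    using triangular_gen_eigenspan[OF T] by blast
  have "\<not> finite_cdim (complex_vector.span ?B)"
    using e sub
    by (intro infinite_cdim_biorthogonal[of "UNIV::nat set" e e])
      (auto simp: orthonormal_basis_cinner)
  moreover have "finite ?B" using fin B(1) by blast
  ultimately show False unfolding finite_cdim_def by blast
qed

section \<open>Half-spaces\<close>

text \<open>A commuting operator preserves each eigenspace, then the span by linearity and its
  closure by continuity.\<close>

lemma hyperinvariant_closure_span_eigenspaces:
  fixes T :: "'a::complex_inner \<Rightarrow> 'a"
  shows "hyperinvariant T (closure (complex_vector.span (\<Union>a\<in>L. {x. T x = a *\<^sub>C x})))"
  unfolding hyperinvariant_def invariant_under_def
proof (intro allI impI, elim conjE)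
  let ?E = "\<Union>a\<in>L. {x. T x = a *\<^sub>C x}"
  fix A :: "'a \<Rightarrow> 'a" assume A: "bounded_clinear A" "A \<circ> T = T \<circ> A"
  note lin = bounded_clinear_imp_clinear[OF A(1)]
  have "A ` ?E \<subseteq> ?E"
  proof clarify
    fix x a assume "a \<in> L" "T x = a *\<^sub>C x"
    moreover have "T (A x) = A (T x)" using fun_cong[OF A(2), of x] by simp
    ultimately have "T (A x) = a *\<^sub>C A x" using clinear.linear_scale[OF lin] by simp
    thus "A x \<in> ?E" using \<open>a \<in> L\<close> by blast
  qed
  hence "A ` complex_vector.span ?E \<subseteq> complex_vector.span ?E"
    unfolding clinear.linear_span_image[OF lin, symmetric] by (rule complex_vector.span_mono)
  moreover have "continuous_on (closure (complex_vector.span ?E)) A"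
    using A(1) linear_continuous_on unfolding bounded_clinear_def by blast
  ultimately show "A ` closure (complex_vector.span ?E) \<subseteq> closure (complex_vector.span ?E)"
    using closure_subset by (intro image_closure_subset) auto
qed

lemma half_space_closure_span_eigenspaces:
  fixes T S :: "'a::complex_inner \<Rightarrow> 'a"
  assumes T: "clinear T" and adj: "\<And>x y. cinner (T x) y = cinner x (S y)" and S: "triangular S"
    and inf: "infinite {a. \<exists>x. x \<noteq> 0 \<and> T x = a *\<^sub>C x}"
  shows "\<exists>L. half_space (closure (complex_vector.span (\<Union>a\<in>L. {x. T x = a *\<^sub>C x})))"
proof -
  obtain a :: "nat \<Rightarrow> complex" where a: "inj a" "range a \<subseteq> {a. \<exists>x. x \<noteq> 0 \<and> T x = a *\<^sub>C x}"
    using infinite_countable_subset[OF inf] by blast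
  hence "\<forall>n. \<exists>x. x \<noteq> 0 \<and> T x = a n *\<^sub>C x" by blast
  then obtain x where x: "\<And>n. x n \<noteq> 0" "\<And>n. T (x n) = a n *\<^sub>C x n" by metis
  \<comment> \<open>Partners on the adjoint side; distinctness of the \<open>a n\<close> makes them
    biorthogonal to the \<open>x n\<close> up to scaling.\<close>
  obtain y where y: "\<And>n. y n \<in> gen_eigenspace S (cnj (a n))" "\<And>n. cinner (x n) (y n) \<noteq> 0"
    using eigenvector_not_orthogonal[of T S, OF adj S x(2) x(1)] by metis
  have orth: "cinner (x m) (y n) = 0" if "m \<noteq> n" for m n
    using gen_eigenspace_orthogonal[of T S, OF adj x(2) y(1)] that a(1) by (meson injD)
  \<comment> \<open>Whole eigenspaces for even indices, not just the chosen \<open>x n\<close>, so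
    that the closed span is hyperinvariant; the odd indices are kept for the codimension.\<close>
  let ?E = "\<Union>b\<in>a ` {n. even n}. {x. T x = b *\<^sub>C x}"
  let ?M = "closure (complex_vector.span ?E)"
  have "x n \<in> ?M" if "even n" for n
  proof -
    have "x n \<in> ?E" using that x(2) by blast
    thus ?thesis by (rule closure_span_base)
  qed
  hence "\<not> finite_cdim ?M"
    using infinite_cdim_biorthogonal[OF infinite_even, of x y] y(2) orth by auto
  moreover have "y n \<in> {y. \<forall>x\<in>?M. cinner x y = 0}" if n: "odd n" for n
  proof -
    have "cinner z (y n) = 0" if z: "z \<in> ?E" for z
    proof -
      obtain m where m: "even m" "T z = a m *\<^sub>C z" using z by blast
      have "a m \<noteq> a n" using m(1) n a(1) by (auto dest: injD)
      thus ?thesis by (rule gen_eigenspace_orthogonal[of T S, OF adj m(2) y(1)])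
    qed
    hence "cinner z (y n) = 0" if "z \<in> ?M" for z
      using that by (rule cinner_closure_span_eq_0)
    thus ?thesis by blast
  qed
  \<comment> \<open>Roles exchanged: the odd-indexed \<open>y n\<close> are now the independent
    family, tested against the \<open>x n\<close>.\<close>
  hence "\<not> finite_cdim {y. \<forall>x\<in>?M. cinner x y = 0}"
    using y(2) orth
    by (intro infinite_cdim_biorthogonal[OF infinite_odd, of y x]) (auto simp: cinner_commute[of "y _"])
  hence "\<not> finite_ccodim ?M" by (rule infinite_ccodimI)
  ultimately have "half_space ?M" unfolding half_space_def using closed_csubspace_closure_span by blast
  thus ?thesis by blast
qed

section \<open>Scalar plus finite rank\<close>

lemma finite_cdim_range_if_finite_ccodim_ker:
  fixes f :: "'a::complex_vector \<Rightarrow> 'a"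
  assumes f: "clinear f" and "finite_ccodim {x. f x = 0}"
  shows "finite_cdim (range f)"
proof -
  obtain B where B: "finite B" "complex_vector.span ({x. f x = 0} \<union> B) = UNIV"
    using assms(2) unfolding finite_ccodim_def by blast
  have "range f = complex_vector.span (f ` ({x. f x = 0} \<union> B))"
    using clinear.linear_span_image[OF f] B(2) by metis
  also have "f ` ({x. f x = 0} \<union> B) = insert 0 (f ` B)"
    using clinear.linear_0[OF f] by force
  finally have "range f = complex_vector.span (insert 0 (f ` B))" .
  thus ?thesis unfolding finite_cdim_def using B(1) by (intro exI[of _ "insert 0 (f ` B)"]) simp
qed

text \<open>Serves the finite-rank case: a half-space containing the range of \<open>F\<close> is
  invariant under a scalar plus \<open>F\<close>. It is built by adjoining generators of
  \<open>V\<close> to half of a basis.\<close>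

lemma half_space_superset:
  fixes e :: "nat \<Rightarrow> 'a::complex_inner"
  assumes e: "orthonormal_basis e" and V: "finite_cdim (V :: 'a set)"
  shows "\<exists>M. half_space M \<and> V \<subseteq> M"
proof -
  obtain B where B: "finite B" "V = complex_vector.span B" using V unfolding finite_cdim_def by blast
  let ?X = "B \<union> e ` {n. even n}"
  let ?M = "closure (complex_vector.span ?X)"
  let ?S = "complex_vector.span (e ` {n. odd n})"
  have "e n \<in> ?M" if "even n" for n
    using that by (intro closure_span_base) blast
  hence "\<not> finite_cdim ?M"
    by (intro infinite_cdim_biorthogonal[OF infinite_even, of e e]) (auto simp: orthonormal_basis_cinner[OF e])
  moreover have "\<not> finite_cdim ?S"
    by (intro infinite_cdim_biorthogonal[OF infinite_odd, of e e])
      (auto simp: orthonormal_basis_cinner[OF e] intro: complex_vector.span_base)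
  \<comment> \<open>Orthogonality to the finite set \<open>B\<close> leaves an infinite-dimensional
    part of the odd span, which lies in the orthogonal complement of \<open>?M\<close>.\<close>
  hence W: "\<not> finite_cdim {y \<in> ?S. \<forall>b\<in>B. cinner y b = 0}"
    using infinite_cdim_orthogonal_finite[OF _ _ B(1)] complex_vector.subspace_span by blast
  have "\<not> finite_ccodim ?M"
  proof (rule infinite_ccodimI, rule)
    let ?P = "{y. \<forall>x\<in>?M. cinner x y = 0}"
    assume P: "finite_cdim ?P"
    have "{y \<in> ?S. \<forall>b\<in>B. cinner y b = 0} \<subseteq> ?P"
    proof clarify
      fix y x assume y: "y \<in> ?S" "\<forall>b\<in>B. cinner y b = 0" and x: "x \<in> ?M"
      have "cinner y (e n) = 0" if "even n" for n
        using that subsetD[OF closure_subset y(1)]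
        by - (rule cinner_closure_span_eq_0[of "e ` {n. odd n}"]; auto simp: orthonormal_basis_cinner[OF e])
      thus "cinner x y = 0"
        using x y(2) by - (rule cinner_closure_span_eq_0[of ?X]; auto simp: cinner_commute[of _ y])
    qed
    moreover have "complex_vector.subspace {y \<in> ?S. \<forall>b\<in>B. cinner y b = 0}"
      by (rule complex_vector.subspaceI)
        (auto simp: cinner_add_left cinner_scaleC_left intro: complex_vector.span_add
          complex_vector.span_scale complex_vector.span_zero)
    ultimately show False using W finite_cdim_mono[OF P] by blast
  qed
  moreover have "V \<subseteq> ?M"
    unfolding B(2) by (rule order_trans[OF complex_vector.span_mono closure_subset]) blast
  ultimately show ?thesis unfolding half_space_def using closed_csubspace_closure_span by blast
qed

section \<open>Assembling the cases\<close>

lemma bounded_clinear_shifted: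
  assumes "bounded_clinear T" shows "bounded_clinear (shifted T a)"
  unfolding bounded_clinear_def
proof (intro conjI allI)
  show "bounded_linear (shifted T a)"
    using assms bounded_linear_scaleC unfolding bounded_clinear_def
    by (intro bounded_linear_sub) auto
  show "shifted T a (c *\<^sub>C x) = c *\<^sub>C shifted T a x" for c x
    using clinear.linear_scale[OF clinear_shifted[OF bounded_clinear_imp_clinear[OF assms]]] .
qed

theorem theorem2p15:
  fixes T :: "'a::complex_hilbert_space \<Rightarrow> 'a"
  assumes "\<not> finite_cdim (UNIV :: 'a set)"
    and "separable_space (euclidean :: 'a topology)"
    and "bounded_clinear T"
    and "bitriangular T"
  shows "((\<exists>l F. finite_rank F \<and> T = (\<lambda>x. l *\<^sub>C x + F x)) \<or>
          (\<exists>M. half_space M \<and> hyperinvariant T M)) \<and>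
         (\<exists>M. half_space M \<and> invariant_under T M)"
proof -
  note T = bounded_clinear_imp_clinear[OF assms(3)]
  have tri: "triangular T" "triangular (cadjoint T)"
    using assms(4) unfolding bitriangular_def by auto
  \<comment> \<open>A triangularizing basis also serves for the existence of the adjoint and for the
    finite-rank case.\<close>
  then obtain e :: "nat \<Rightarrow> 'a" where e: "orthonormal_basis e" unfolding triangular_def by blast
  note adj = cinner_cadjoint[OF e assms(3)]
  have dichotomy: "(\<exists>l F. finite_rank F \<and> T = (\<lambda>x. l *\<^sub>C x + F x)) \<or>
    (\<exists>M. half_space M \<and> hyperinvariant T M)"
  proof (cases "\<forall>a. finite_cdim {x. shifted T a x = 0}")
    case True
    hence "infinite {a. \<exists>x. x \<noteq> 0 \<and> T x = a *\<^sub>C x}"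
      using infinite_eigenvalues[of T "cadjoint T", OF T tri(1) adj tri(2)] by blast
    thus ?thesis
      using half_space_closure_span_eigenspaces[of T "cadjoint T", OF T adj tri(2)]
        hyperinvariant_closure_span_eigenspaces by blast
  next
    case False
    then obtain a where a: "\<not> finite_cdim {x. shifted T a x = 0}" by blast
    note N = bounded_clinear_shifted[OF assms(3), of a]
    show ?thesis
    proof (cases "finite_ccodim {x. shifted T a x = 0}")
      case True
      hence "finite_rank (shifted T a)"
        unfolding finite_rank_def
        using N finite_cdim_range_if_finite_ccodim_ker[OF clinear_shifted[OF T]] by blast
      moreover have "T = (\<lambda>x. a *\<^sub>C x + shifted T a x)" by simp
      ultimately show ?thesis by blast
    next
      case False
      let ?K = "{x. T x = a *\<^sub>C x}"
      have K: "{x. shifted T a x = 0} = ?K" by simp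
      have "complex_vector.subspace ?K" using subspace_ker[OF clinear_shifted[OF T, of a]] K by simp
      moreover have "closed ?K"
        using assms(3) linear_continuous_on bounded_linear_scaleC unfolding bounded_clinear_def
        by (intro closed_Collect_eq) auto
      ultimately have "half_space ?K"
        unfolding half_space_def closed_csubspace_def using a False K by simp
      moreover have "closure (complex_vector.span ?K) = ?K"
        using \<open>complex_vector.subspace ?K\<close> \<open>closed ?K\<close>
        by (simp only: complex_vector.span_eq_iff[THEN iffD2] closure_closed)
      hence "hyperinvariant T ?K"
        using hyperinvariant_closure_span_eigenspaces[of T "{a}"] by simp
      ultimately show ?thesis by blast
    qed
  qed
  moreover have "\<exists>M. half_space M \<and> invariant_under T M"
    using dichotomy
  proof (elim disjE exE conjE)
    fix l F assume F: "finite_rank F" "T = (\<lambda>x. l *\<^sub>C x + F x)"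
    then obtain M where M: "half_space M" "range F \<subseteq> M"
      using half_space_superset[OF e] unfolding finite_rank_def by blast
    hence "complex_vector.subspace M" unfolding half_space_def closed_csubspace_def by blast
    hence "T x \<in> M" if "x \<in> M" for x
      using that M(2) complex_vector.subspace_add complex_vector.subspace_scale
      unfolding F(2) by (metis rangeI subsetD)
    thus ?thesis using M(1) unfolding invariant_under_def by blast
  next
    fix M assume "half_space M" "hyperinvariant T M"
    thus ?thesis using assms(3) unfolding hyperinvariant_def by blast
  qed
  ultimately show ?thesis by blast
qed

end
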